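(* The trivariate quartic polynomial $$p(x_1,x_2,x_3) = x_1^4 + 2x_1^2 + x_2^4 + 2x_2^2 + x_3^4 + 2x_3^2 + \frac{9}{4} + 8x_1x_2 + 8x_1x_3 + 8x_2x_3$$ is separable plus quadratic (SPQ) and nonnegative, but it is not a sum of squares.
   Context: All polynomials have real coefficients. A polynomial $p:\mathbb{R}^n\to\mathbb{R}$ is separable plus quadratic (SPQ) if $p(x)=s(x)+q(x)$, where $s(x)=\sum_{i=1}^n s_i(x_i)$ for some univariate polynomials $s_i$ and $q(x)$ is a quadratic polynomial (degree at most $2$). A polynomial is nonnegative if $p(x)\ge 0$ for all $x\in\mathbb{R}^n$, and a sum of squares (sos) if $p=\sum_{i=1}^m q_i^2$ for some polynomials $q_1,\dots,q_m$ with real coefficients. *)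

theory Defs
  imports "HOL-Analysis.Analysis" "HOL-Computational_Algebra.Polynomial"
begin

text \<open>
  Polynomials in \<open>n = CARD('n)\<close> variables are polynomial functions on \<open>real ^ 'n\<close>, as given by
  the library predicate \<^const>\<open>real_polynomial_function\<close>. As the reals are infinite,
  polynomial functions correspond to formal polynomials.
\<close>

text \<open>
  Polynomials of total degree at most \<open>d\<close>: finite linear combinations of monomials, where
  \<open>\<alpha> :: 'n \<Rightarrow> nat\<close> is the exponent vector of a monomial. The zero polynomial is included.
\<close>

definition polynomial_degree_le :: "nat \<Rightarrow> (real ^ 'n \<Rightarrow> real) \<Rightarrow> bool" where
  "polynomial_degree_le d p \<longleftrightarrow>
     (\<exists>(A :: ('n \<Rightarrow> nat) set) (c :: ('n \<Rightarrow> nat) \<Rightarrow> real).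
        finite A \<and> (\<forall>\<alpha>\<in>A. (\<Sum>i\<in>UNIV. \<alpha> i) \<le> d) \<and>
        (\<forall>x. p x = (\<Sum>\<alpha>\<in>A. c \<alpha> * (\<Prod>i\<in>UNIV. x $ i ^ \<alpha> i))))"

lemma polynomial_degree_le_imp_real_polynomial_function:
  assumes "polynomial_degree_le d p"
  shows "real_polynomial_function p"
proof -
  obtain A c where A: "finite A"
    and p: "\<And>x. p x = (\<Sum>\<alpha>\<in>A. c \<alpha> * (\<Prod>i\<in>UNIV. x $ i ^ \<alpha> i))"
    using assms unfolding polynomial_degree_le_def by blast
  have "real_polynomial_function (\<lambda>x :: real ^ 'a. c \<alpha> * (\<Prod>i\<in>UNIV. x $ i ^ \<alpha> i))" for \<alpha>
    by (intro real_polynomial_function.intros(2,4)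
        real_polynomial_function_prod real_polynomial_function_power
        real_polynomial_function.intros(1) bounded_linear_vec_nth) auto
  then have "real_polynomial_function (\<lambda>x. \<Sum>\<alpha>\<in>A. c \<alpha> * (\<Prod>i\<in>UNIV. x $ i ^ \<alpha> i))"
    using A by (intro real_polynomial_function_sum) auto
  then show ?thesis
    by (simp add: p[abs_def])
qed

definition separable_plus_quadratic :: "(real ^ 'n \<Rightarrow> real) \<Rightarrow> bool" where
  "separable_plus_quadratic p \<longleftrightarrow>
     (\<exists>(s :: 'n \<Rightarrow> real poly) q. polynomial_degree_le 2 q \<and>
        (\<forall>x. p x = (\<Sum>i\<in>UNIV. poly (s i) (x $ i)) + q x))"

definition nonnegative :: "(real ^ 'n \<Rightarrow> real) \<Rightarrow> bool" where
  "nonnegative p \<longleftrightarrow> (\<forall>x. p x \<ge> 0)"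

definition sum_of_squares :: "(real ^ 'n \<Rightarrow> real) \<Rightarrow> bool" where
  "sum_of_squares p \<longleftrightarrow>
     (\<exists>(m :: nat) (q :: nat \<Rightarrow> real ^ 'n \<Rightarrow> real).
        (\<forall>i\<in>{1..m}. real_polynomial_function (q i)) \<and>
        (\<forall>x. p x = (\<Sum>i=1..m. (q i x)\<^sup>2)))"

end

theory Submission
  imports Defs "HOL-Computational_Algebra.Fundamental_Theorem_Algebra"
begin

text \<open>
  With \<open>\<sigma> = x\<^sub>1 + x\<^sub>2 + x\<^sub>3\<close> we have \<open>p = (\<Sum>i. (x\<^sub>i\<^sup>2 - 1)\<^sup>2) + 4 \<sigma>\<^sup>2 - 3/4\<close>.
  Two of the three coordinates have the same sign, say \<open>x\<close> and \<open>y\<close>. If \<open>(x + y)\<^sup>2 \<le> 3/2\<close>, then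
  \<open>(x\<^sup>2 - 1)\<^sup>2 + (y\<^sup>2 - 1)\<^sup>2\<close> alone is at least \<open>3/4\<close>; otherwise it is bounded below by a
  polynomial in \<open>x + y\<close>, and the resulting bivariate quartic is an explicit sum of squares.

  If \<open>p = (\<Sum>i. q\<^sub>i\<^sup>2)\<close>, then \<open>\<bar>q\<^sub>i\<bar>\<close> grows at most quadratically, so each \<open>q\<^sub>i\<close> has degree
  at most 2. A signed combination of point evaluations on \<open>{-1, 0, 1}\<^sup>3\<close> that is nonnegative on
  squares of quadratic polynomials but negative on \<open>p\<close> gives the contradiction.
\<close>

section \<open>Closure properties of polynomials of bounded degree\<close>

lemma polynomial_degree_le_mono:
  "polynomial_degree_le d f \<Longrightarrow> d \<le> e \<Longrightarrow> polynomial_degree_le e f"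
  unfolding polynomial_degree_le_def by (meson order_trans)

lemma polynomial_degree_le_monomial:
  fixes \<alpha> :: "'n::finite \<Rightarrow> nat"
  assumes "(\<Sum>i\<in>UNIV. \<alpha> i) \<le> d"
  shows "polynomial_degree_le d (\<lambda>x. c * (\<Prod>i\<in>UNIV. x $ i ^ \<alpha> i))"
  unfolding polynomial_degree_le_def
  by (rule exI[of _ "{\<alpha>}"], rule exI[of _ "\<lambda>_. c"]) (use assms in auto)

lemma polynomial_degree_le_add:
  assumes "polynomial_degree_le d f" "polynomial_degree_le d g"
  shows "polynomial_degree_le d (\<lambda>x. f x + g x)"
proof -
  obtain A a where A: "finite A" "\<forall>\<alpha>\<in>A. (\<Sum>i\<in>UNIV. \<alpha> i) \<le> d"
    "\<And>x. f x = (\<Sum>\<alpha>\<in>A. a \<alpha> * (\<Prod>i\<in>UNIV. x $ i ^ \<alpha> i))"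
    using assms(1) unfolding polynomial_degree_le_def by blast
  obtain B b where B: "finite B" "\<forall>\<alpha>\<in>B. (\<Sum>i\<in>UNIV. \<alpha> i) \<le> d"
    "\<And>x. g x = (\<Sum>\<alpha>\<in>B. b \<alpha> * (\<Prod>i\<in>UNIV. x $ i ^ \<alpha> i))"
    using assms(2) unfolding polynomial_degree_le_def by blast
  \<comment> \<open>Both coefficient families are extended by zero to \<open>A \<union> B\<close>,
    so on the overlap they add up.\<close>
  define c where "c \<alpha> = (if \<alpha> \<in> A then a \<alpha> else 0) + (if \<alpha> \<in> B then b \<alpha> else 0)" for \<alpha>
  have "f x + g x = (\<Sum>\<alpha>\<in>A \<union> B. c \<alpha> * (\<Prod>i\<in>UNIV. x $ i ^ \<alpha> i))" for x
  proof -
    have "f x = (\<Sum>\<alpha>\<in>A \<union> B. (if \<alpha> \<in> A then a \<alpha> else 0) * (\<Prod>i\<in>UNIV. x $ i ^ \<alpha> i))"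
      unfolding A(3) by (rule sum.mono_neutral_cong_left) (use A B in auto)
    moreover have "g x = (\<Sum>\<alpha>\<in>A \<union> B. (if \<alpha> \<in> B then b \<alpha> else 0) * (\<Prod>i\<in>UNIV. x $ i ^ \<alpha> i))"
      unfolding B(3) by (rule sum.mono_neutral_cong_left) (use A B in auto)
    ultimately show ?thesis
      by (simp only: c_def distrib_right sum.distrib)
  qed
  then show ?thesis
    unfolding polynomial_degree_le_def using A(1,2) B(1,2)
    by (intro exI[of _ "A \<union> B"] exI[of _ c]) auto
qed

lemma polynomial_degree_le_const: "polynomial_degree_le d (\<lambda>x. c)"
  using polynomial_degree_le_monomial[of "\<lambda>_. 0" d c] by simp

lemma polynomial_degree_le_sum:
  assumes "\<And>i. i \<in> I \<Longrightarrow> polynomial_degree_le d (f i)"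
  shows "polynomial_degree_le d (\<lambda>x. \<Sum>i\<in>I. f i x)"
  using assms
  by (induction I rule: infinite_finite_induct)
    (auto intro: polynomial_degree_le_const polynomial_degree_le_add)

text \<open>The product is kept as a double sum over pairs of monomials. Pairs with the same
  exponent vector stay uncollected, as closure under sums takes care of them.\<close>

lemma polynomial_degree_le_mult:
  assumes "polynomial_degree_le d f" "polynomial_degree_le e g"
  shows "polynomial_degree_le (d + e) (\<lambda>x. f x * g x)"
proof -
  obtain A a where A: "\<forall>\<alpha>\<in>A. (\<Sum>i\<in>UNIV. \<alpha> i) \<le> d"
    "\<And>x. f x = (\<Sum>\<alpha>\<in>A. a \<alpha> * (\<Prod>i\<in>UNIV. x $ i ^ \<alpha> i))"
    using assms(1) unfolding polynomial_degree_le_def by blast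
  obtain B b where B: "\<forall>\<alpha>\<in>B. (\<Sum>i\<in>UNIV. \<alpha> i) \<le> e"
    "\<And>x. g x = (\<Sum>\<alpha>\<in>B. b \<alpha> * (\<Prod>i\<in>UNIV. x $ i ^ \<alpha> i))"
    using assms(2) unfolding polynomial_degree_le_def by blast
  have "f x * g x = (\<Sum>\<alpha>\<in>A. \<Sum>\<beta>\<in>B. a \<alpha> * b \<beta> * (\<Prod>i\<in>UNIV. x $ i ^ (\<alpha> i + \<beta> i)))" for x
    by (simp add: A(2) B(2) sum_product power_add prod.distrib ac_simps)
  moreover have "polynomial_degree_le (d + e)
      (\<lambda>x. \<Sum>\<alpha>\<in>A. \<Sum>\<beta>\<in>B. a \<alpha> * b \<beta> * (\<Prod>i\<in>UNIV. x $ i ^ (\<alpha> i + \<beta> i)))"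
    by (intro polynomial_degree_le_sum polynomial_degree_le_monomial)
      (use A(1) B(1) in \<open>auto simp: sum.distrib intro: add_mono\<close>)
  ultimately show ?thesis
    by presburger
qed

lemma polynomial_degree_le_component: "polynomial_degree_le 1 (\<lambda>x. x $ k)"
proof -
  have "(\<Prod>i\<in>UNIV. x $ i ^ (if i = k then 1 else 0)) = x $ k" for x :: "real ^ 'a"
  proof -
    have "(\<Prod>i\<in>UNIV. x $ i ^ (if i = k then 1 else 0)) = (\<Prod>i\<in>UNIV. if i = k then x $ i else 1)"
      by (rule prod.cong) auto
    then show ?thesis
      by simp
  qed
  then show ?thesis
    using polynomial_degree_le_monomial[of "\<lambda>i. if i = k then 1 else 0" 1 1] by simp
qed

text \<open>Supplies explicit coefficients for an abstract polynomial function. Linear generators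
  are expanded in the standard basis.\<close>

lemma real_polynomial_function_imp_polynomial_degree_le:
  fixes f :: "real ^ 'n \<Rightarrow> real"
  assumes "real_polynomial_function f"
  shows "\<exists>d. polynomial_degree_le d f"
  using assms
proof (induction rule: real_polynomial_function.induct)
  case (linear f)
  have eq: "f x = (\<Sum>i\<in>UNIV. f (axis i 1) * x $ i)" for x
  proof -
    have "f x = f (\<Sum>i\<in>UNIV. x $ i *\<^sub>R axis i 1)"
      using basis_expansion[of x] by (simp add: scalar_mult_eq_scaleR)
    also have "\<dots> = (\<Sum>i\<in>UNIV. f (axis i 1) * x $ i)"
      using linear by (simp add: bounded_linear.linear linear_sum linear_scale mult.commute)
    finally show ?thesis .
  qed
  have "polynomial_degree_le (0 + 1) f \<longleftrightarrow>
      polynomial_degree_le (0 + 1) (\<lambda>x. \<Sum>i\<in>UNIV. f (axis i 1) * x $ i)"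
    by (rule arg_cong[of f], rule ext) (rule eq)
  moreover have "polynomial_degree_le (0 + 1) (\<lambda>x. \<Sum>i\<in>UNIV. f (axis i 1) * x $ i)"
    by (intro polynomial_degree_le_sum polynomial_degree_le_mult
        polynomial_degree_le_const polynomial_degree_le_component)
  ultimately have "polynomial_degree_le (0 + 1) f"
    by (rule iffD2)
  then show ?case ..
next
  case (const c)
  then show ?case
    using polynomial_degree_le_const by blast
next
  case (add f g)
  then show ?case
    by (metis polynomial_degree_le_add polynomial_degree_le_mono max.cobounded1 max.cobounded2)
next
  case (mult f g)
  then show ?case
    using polynomial_degree_le_mult by blast
qed

section \<open>Degree bounds from growth bounds\<close>

text \<open>Induction on \<open>d\<close> strips the constant term: if \<open>P = a + t * Q\<close>,
  dividing by \<open>t\<close> bounds \<open>Q\<close> with exponent one lower. At exponent 0, a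
  nonconstant polynomial would be unbounded.\<close>

lemma degree_le_if_bounded_by_power:
  fixes P :: "real poly"
  assumes "\<And>t. t \<ge> 1 \<Longrightarrow> \<bar>poly P t\<bar> \<le> C * t ^ d"
  shows "degree P \<le> d"
  using assms
proof (induction d arbitrary: P C)
  case 0
  show ?case
  proof (rule ccontr)
    assume "\<not> degree P \<le> 0"
    then obtain a Q where P: "P = pCons a Q" and "Q \<noteq> 0"
      by (metis degree_pCons_0 le_refl pCons_cases)
    then obtain r where r: "\<And>z. r \<le> norm z \<Longrightarrow> C + 1 \<le> norm (poly P z)"
      using poly_infinity[of Q "C + 1" a] by blast
    show False
      using r[of "max r 1"] 0[of "max r 1"] by auto
  qed
next
  case (Suc d)
  obtain a Q where P: "P = pCons a Q"
    by (rule pCons_cases)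
  have "\<bar>poly Q t\<bar> \<le> (C + \<bar>a\<bar>) * t ^ d" if t: "t \<ge> 1" for t
  proof -
    have "t * \<bar>poly Q t\<bar> = \<bar>poly P t - a\<bar>"
      using t by (simp add: P abs_mult)
    also have "\<dots> \<le> C * t ^ Suc d + \<bar>a\<bar>"
      using Suc.prems[OF t] by linarith
    also have "\<dots> \<le> C * t ^ Suc d + \<bar>a\<bar> * t ^ Suc d"
      using mult_left_mono[OF one_le_power[OF t], of "\<bar>a\<bar>" "Suc d"] by simp
    finally have "t * \<bar>poly Q t\<bar> \<le> t * ((C + \<bar>a\<bar>) * t ^ d)"
      by (simp add: algebra_simps)
    then show ?thesis
      using t by simp
  qed
  then have "degree Q \<le> d"
    by (rule Suc.IH)
  then show ?case
    using degree_pCons_le[of a Q] by (simp add: P)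
qed

lemma polynomial_degree_le_if_growth:
  fixes f :: "real ^ 'n \<Rightarrow> real"
  assumes "real_polynomial_function f"
    and bound: "\<And>x. \<bar>f x\<bar> \<le> C * (1 + norm x ^ d)"
  shows "polynomial_degree_le d f"
proof -
  obtain A c where A: "finite A"
    and f: "\<And>x. f x = (\<Sum>\<alpha>\<in>A. c \<alpha> * (\<Prod>i\<in>UNIV. x $ i ^ \<alpha> i))"
    using real_polynomial_function_imp_polynomial_degree_le[OF assms(1)]
    unfolding polynomial_degree_le_def by blast
  let ?B = "{\<alpha>\<in>A. (\<Sum>i\<in>UNIV. \<alpha> i) \<le> d}"
  \<comment> \<open>At the origin the factor of \<open>C\<close> is 1, or 2 if \<open>d = 0\<close>
    because \<open>0 ^ 0 = 1\<close>; it is positive either way.\<close>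
  have "0 \<le> C * (1 + norm (0 :: real ^ 'n) ^ d)"
    using bound[of 0] by linarith
  then have C: "C \<ge> 0"
    by (simp add: zero_le_mult_iff power_0_left split: if_splits)
  have "f x = (\<Sum>\<alpha>\<in>?B. c \<alpha> * (\<Prod>i\<in>UNIV. x $ i ^ \<alpha> i))" for x
  proof -
    define P where
      "P = (\<Sum>\<alpha>\<in>A. monom (c \<alpha> * (\<Prod>i\<in>UNIV. x $ i ^ \<alpha> i)) (\<Sum>i\<in>UNIV. \<alpha> i))"
    have P: "poly P t = f (t *\<^sub>R x)" for t
      by (simp add: P_def f poly_sum poly_monom power_mult_distrib prod.distrib
          power_sum ac_simps)
    have "\<bar>poly P t\<bar> \<le> (C * (1 + norm x ^ d)) * t ^ d" if t: "t \<ge> 1" for t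
    proof -
      have "\<bar>poly P t\<bar> \<le> C * (1 + norm (t *\<^sub>R x) ^ d)"
        unfolding P by (rule bound)
      also have "\<dots> \<le> C * (t ^ d + t ^ d * norm x ^ d)"
        using t C by (intro mult_left_mono add_mono) (auto simp: power_mult_distrib)
      finally show ?thesis
        by (simp add: algebra_simps)
    qed
    then have deg: "degree P \<le> d"
      by (rule degree_le_if_bounded_by_power)
    have "f x = poly P 1"
      by (simp add: P)
    also have "\<dots> = (\<Sum>k\<le>degree P. coeff P k)"
      by (simp add: poly_altdef)
    also have "\<dots> = (\<Sum>k\<le>d. coeff P k)"
      using deg by (intro sum.mono_neutral_left) (auto intro: coeff_eq_0)
    also have "\<dots> = (\<Sum>k\<le>d. \<Sum>\<alpha>\<in>A.
        if (\<Sum>i\<in>UNIV. \<alpha> i) = k then c \<alpha> * (\<Prod>i\<in>UNIV. x $ i ^ \<alpha> i) else 0)"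
      by (simp add: P_def coeff_sum)
    also have "\<dots> = (\<Sum>\<alpha>\<in>A. \<Sum>k\<le>d.
        if (\<Sum>i\<in>UNIV. \<alpha> i) = k then c \<alpha> * (\<Prod>i\<in>UNIV. x $ i ^ \<alpha> i) else 0)"
      by (rule sum.swap)
    also have "\<dots> = (\<Sum>\<alpha>\<in>?B. c \<alpha> * (\<Prod>i\<in>UNIV. x $ i ^ \<alpha> i))"
      using A by (simp add: sum.inter_filter)
    finally show ?thesis .
  qed
  then show ?thesis
    unfolding polynomial_degree_le_def using A
    by (intro exI[of _ ?B] exI[of _ c]) auto
qed

section \<open>Normal form of quadratic polynomials in three variables\<close>

text \<open>The coefficient \<open>b1\<close> belongs to the product of the two variables other than
  \<open>x $ 1\<close>, and so on cyclically, so permuting the variables permutes \<open>l\<close>,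
  \<open>a\<close> and \<open>b\<close> alike. Triples make addition of coefficients the addition of
  the product type.\<close>

definition ternary_quadratic ::
    "real \<Rightarrow> real \<times> real \<times> real \<Rightarrow> real \<times> real \<times> real \<Rightarrow> real \<times> real \<times> real \<Rightarrow>
     real ^ 3 \<Rightarrow> real" where
  "ternary_quadratic k l a b x = (case (l, a, b) of ((l1, l2, l3), (a1, a2, a3), (b1, b2, b3)) \<Rightarrow>
     k + l1 * x $ 1 + l2 * x $ 2 + l3 * x $ 3
     + a1 * (x $ 1)\<^sup>2 + a2 * (x $ 2)\<^sup>2 + a3 * (x $ 3)\<^sup>2
     + b1 * (x $ 2 * x $ 3) + b2 * (x $ 1 * x $ 3) + b3 * (x $ 1 * x $ 2))"

lemma ternary_quadratic_add:
  "ternary_quadratic k l a b x + ternary_quadratic k' l' a' b' x =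
   ternary_quadratic (k + k') (l + l') (a + a') (b + b') x"
  by (cases l; cases l'; cases a; cases a'; cases b; cases b')
    (simp add: ternary_quadratic_def algebra_simps)

lemma ternary_quadratic_monomial:
  fixes \<alpha> :: "3 \<Rightarrow> nat"
  assumes "(\<Sum>i\<in>UNIV. \<alpha> i) \<le> 2"
  shows "\<exists>k l a b. (\<lambda>x. c * (\<Prod>i\<in>UNIV. x $ i ^ \<alpha> i)) = ternary_quadratic k l a b"
    (is "\<exists>k l a b. ?m = _ k l a b")
proof -
  have prod3: "(\<Prod>i\<in>UNIV. x $ i ^ \<alpha> i) = x $ 1 ^ \<alpha> 1 * (x $ 2 ^ \<alpha> 2 * x $ 3 ^ \<alpha> 3)"
    for x :: "real ^ 3"
    unfolding UNIV_3 by simp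
  have "\<alpha> 1 + \<alpha> 2 + \<alpha> 3 \<le> 2"
    using assms by (simp add: sum_3)
  then consider "\<alpha> 1 = 0" "\<alpha> 2 = 0" "\<alpha> 3 = 0"
    | "\<alpha> 1 = 1" "\<alpha> 2 = 0" "\<alpha> 3 = 0" | "\<alpha> 1 = 0" "\<alpha> 2 = 1" "\<alpha> 3 = 0"
    | "\<alpha> 1 = 0" "\<alpha> 2 = 0" "\<alpha> 3 = 1" | "\<alpha> 1 = 2" "\<alpha> 2 = 0" "\<alpha> 3 = 0"
    | "\<alpha> 1 = 0" "\<alpha> 2 = 2" "\<alpha> 3 = 0" | "\<alpha> 1 = 0" "\<alpha> 2 = 0" "\<alpha> 3 = 2"
    | "\<alpha> 1 = 0" "\<alpha> 2 = 1" "\<alpha> 3 = 1" | "\<alpha> 1 = 1" "\<alpha> 2 = 0" "\<alpha> 3 = 1"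
    | "\<alpha> 1 = 1" "\<alpha> 2 = 1" "\<alpha> 3 = 0"
    by atomize_elim arith
  then show ?thesis
  proof cases
    case 1
    then have "?m = ternary_quadratic c 0 0 0"
      by (simp add: prod3 ternary_quadratic_def fun_eq_iff zero_prod_def)
    then show ?thesis by blast
  next
    case 2
    then have "?m = ternary_quadratic 0 (c, 0, 0) 0 0"
      by (simp add: prod3 ternary_quadratic_def fun_eq_iff zero_prod_def)
    then show ?thesis by blast
  next
    case 3
    then have "?m = ternary_quadratic 0 (0, c, 0) 0 0"
      by (simp add: prod3 ternary_quadratic_def fun_eq_iff zero_prod_def)
    then show ?thesis by blast
  next
    case 4
    then have "?m = ternary_quadratic 0 (0, 0, c) 0 0"
      by (simp add: prod3 ternary_quadratic_def fun_eq_iff zero_prod_def)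
    then show ?thesis by blast
  next
    case 5
    then have "?m = ternary_quadratic 0 0 (c, 0, 0) 0"
      by (simp add: prod3 ternary_quadratic_def fun_eq_iff zero_prod_def)
    then show ?thesis by blast
  next
    case 6
    then have "?m = ternary_quadratic 0 0 (0, c, 0) 0"
      by (simp add: prod3 ternary_quadratic_def fun_eq_iff zero_prod_def)
    then show ?thesis by blast
  next
    case 7
    then have "?m = ternary_quadratic 0 0 (0, 0, c) 0"
      by (simp add: prod3 ternary_quadratic_def fun_eq_iff zero_prod_def)
    then show ?thesis by blast
  next
    case 8
    then have "?m = ternary_quadratic 0 0 0 (c, 0, 0)"
      by (simp add: prod3 ternary_quadratic_def fun_eq_iff zero_prod_def)
    then show ?thesis by blast
  next
    case 9
    then have "?m = ternary_quadratic 0 0 0 (0, c, 0)"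
      by (simp add: prod3 ternary_quadratic_def fun_eq_iff zero_prod_def)
    then show ?thesis by blast
  next
    case 10
    then have "?m = ternary_quadratic 0 0 0 (0, 0, c)"
      by (simp add: prod3 ternary_quadratic_def fun_eq_iff zero_prod_def)
    then show ?thesis by blast
  qed
qed

lemma polynomial_degree_le_2_imp_ternary_quadratic:
  fixes f :: "real ^ 3 \<Rightarrow> real"
  assumes "polynomial_degree_le 2 f"
  shows "\<exists>k l a b. f = ternary_quadratic k l a b"
proof -
  obtain A c where A: "finite A" "\<forall>\<alpha>\<in>A. (\<Sum>i\<in>UNIV. \<alpha> i) \<le> 2"
    and f: "\<And>x. f x = (\<Sum>\<alpha>\<in>A. c \<alpha> * (\<Prod>i\<in>UNIV. x $ i ^ \<alpha> i))"
    using assms unfolding polynomial_degree_le_def by blast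
  from A have "\<exists>k l a b. (\<lambda>x. \<Sum>\<alpha>\<in>A. c \<alpha> * (\<Prod>i\<in>UNIV. x $ i ^ \<alpha> i)) = ternary_quadratic k l a b"
  proof (induction A rule: finite_induct)
    case empty
    show ?case
      by (rule exI[of _ 0], rule exI[of _ 0], rule exI[of _ 0], rule exI[of _ 0])
        (simp add: ternary_quadratic_def fun_eq_iff zero_prod_def)
  next
    case (insert \<alpha> A)
    then show ?case
      using ternary_quadratic_monomial[of \<alpha> "c \<alpha>"]
      by (auto simp: fun_eq_iff ternary_quadratic_add) blast
  qed
  then show ?thesis
    by (simp add: f[abs_def])
qed

section \<open>A functional separating the quartic from the sums of squares\<close>

text \<open>
  The weights are chosen so that \<open>L = cube_functional / 200\<close> has the pseudo-moments
  \<open>L 1 = 1\<close>, \<open>L x\<^sub>i\<^sup>2 = L x\<^sub>i\<^sup>4 = 19/25\<close>, \<open>L (x\<^sub>i x\<^sub>j) = L (x\<^sub>i\<^sup>3 x\<^sub>j) = -19/50\<close>,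
  \<open>L (x\<^sub>i\<^sup>2 x\<^sub>j\<^sup>2) = 16/25\<close> and \<open>L (x\<^sub>i\<^sup>2 x\<^sub>j x\<^sub>k) = -1/10\<close>, whose moment matrix is
  positive semidefinite.
\<close>

definition cube_functional :: "(real ^ 3 \<Rightarrow> real) \<Rightarrow> real" where
  "cube_functional g =
     68 * g (vector [0, 0, 0])
     - 22 * (g (vector [1, 0, 0]) + g (vector [-1, 0, 0]) + g (vector [0, 1, 0])
       + g (vector [0, -1, 0]) + g (vector [0, 0, 1]) + g (vector [0, 0, -1]))
     + 3 * (g (vector [1, 1, 0]) + g (vector [-1, -1, 0]) + g (vector [1, 0, 1])
       + g (vector [-1, 0, -1]) + g (vector [0, 1, 1]) + g (vector [0, -1, -1]))
     + 31 * (g (vector [1, -1, 0]) + g (vector [-1, 1, 0]) + g (vector [1, 0, -1])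
       + g (vector [-1, 0, 1]) + g (vector [0, 1, -1]) + g (vector [0, -1, 1]))
     + 10 * (g (vector [1, 1, -1]) + g (vector [-1, -1, 1]) + g (vector [1, -1, 1])
       + g (vector [-1, 1, -1]) + g (vector [-1, 1, 1]) + g (vector [1, -1, -1]))"

lemma cube_functional_sum:
  "cube_functional (\<lambda>x. \<Sum>i\<in>I. g i x) = (\<Sum>i\<in>I. cube_functional (g i))"
  by (simp add: cube_functional_def sum.distrib sum_subtractf sum_distrib_left)

text \<open>An explicit diagonalization of the moment form. Invariance of the weights under
  \<open>x \<mapsto> -x\<close> decouples \<open>l\<close> from \<open>k\<close>, \<open>a\<close>,
  \<open>b\<close>; invariance under permutations separates coefficient differences from the sums
  \<open>A\<close> and \<open>B\<close>.\<close>

lemma cube_functional_square_nonneg: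
  "cube_functional (\<lambda>x. (ternary_quadratic k l a b x)\<^sup>2) \<ge> 0"
proof -
  obtain l1 l2 l3 a1 a2 a3 b1 b2 b3
    where [simp]: "l = (l1, l2, l3)" "a = (a1, a2, a3)" "b = (b1, b2, b3)"
    by (metis prod.exhaust)
  \<comment> \<open>The shift 7/3 = (-1/10 + 19/50) / (19/25 - 16/25) completes the square between
    \<open>a\<close> and \<open>b\<close> on vectors of coordinate sum zero.\<close>
  define d1 d2 d3 where d: "d1 = a1 + 7/3 * b1" "d2 = a2 + 7/3 * b2" "d3 = a3 + 7/3 * b3"
  define A B where AB: "A = a1 + a2 + a3" "B = b1 + b2 + b3"
  have "cube_functional (\<lambda>x. (ternary_quadratic k l a b x)\<^sup>2) =
    200 * (38/100 * ((l1 - l2)\<^sup>2 + (l1 - l3)\<^sup>2 + (l2 - l3)\<^sup>2)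
      + (k + 76/100 * A - 38/100 * B)\<^sup>2
      + 1/25 * ((d1 - d2)\<^sup>2 + (d1 - d3)\<^sup>2 + (d2 - d3)\<^sup>2)
      + 13/450 * ((b1 - b2)\<^sup>2 + (b1 - b3)\<^sup>2 + (b2 - b3)\<^sup>2)
      + 64/625 * (A + B / 48)\<^sup>2 + 1/450 * B\<^sup>2)"
    unfolding cube_functional_def ternary_quadratic_def d AB
    by simp (simp add: power2_eq_square field_simps)
  then show ?thesis
    by simp
qed

section \<open>Nonnegativity of the quartic\<close>

text \<open>For fixed \<open>x + y\<close> the left side is a quadratic in \<open>P = x * y\<close>,
  where \<open>0 \<le> P \<le> U / 4\<close>. The second argument of \<open>min\<close> is its value
  at \<open>x = y\<close>, that is, at \<open>P = U / 4\<close>.\<close>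

lemma two_variable_bound:
  fixes x y :: real
  assumes "x * y \<ge> 0"
  shows "(x\<^sup>2 - 1)\<^sup>2 + (y\<^sup>2 - 1)\<^sup>2 - 3/4 \<ge> min 0 ((x + y)^4 / 8 - (x + y)\<^sup>2 + 5/4)"
proof -
  define U where "U = (x + y)\<^sup>2"
  define P where "P = x * y"
  have eq: "(x\<^sup>2 - 1)\<^sup>2 + (y\<^sup>2 - 1)\<^sup>2 - 3/4 = 2 * (U - 1 - P)\<^sup>2 - (U - 1)\<^sup>2 + 1/4"
    unfolding U_def P_def by (simp add: power2_eq_square algebra_simps)
  have U4: "(x + y)^4 = U\<^sup>2"
    by (simp add: U_def flip: power_mult)
  have P: "0 \<le> P" "4 * P \<le> U"
    using assms zero_le_power2[of "x - y"]
    by (auto simp: U_def P_def power2_eq_square algebra_simps)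
  consider "U \<le> 1" | "1 \<le> U" "U \<le> 3/2" | "U \<ge> 3/2"
    by linarith
  then show ?thesis
  proof cases
    case 1
    then have "(1 - U)\<^sup>2 \<le> (1 - U + P)\<^sup>2"
      using P by (intro power_mono) auto
    moreover have "(U - 1)\<^sup>2 = (1 - U)\<^sup>2" "(U - 1 - P)\<^sup>2 = (1 - U + P)\<^sup>2"
      by (simp_all add: power2_eq_square algebra_simps)
    ultimately show ?thesis
      \<comment> \<open>Here the least value occurs at \<open>P = 0\<close> and equals
        \<open>(1 - U)\<^sup>2 + 1/4\<close>.\<close>
      unfolding eq using zero_le_power2[of "1 - U"] by linarith
  next
    case 2
    then have "(U - 1)\<^sup>2 \<le> (1/2)\<^sup>2"
      by (intro power_mono) auto
    then have "(U - 1)\<^sup>2 \<le> 1/4"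
      by (simp add: power2_eq_square)
    then show ?thesis
      unfolding eq using zero_le_power2[of "U - 1 - P"] by linarith
  next
    case 3
    \<comment> \<open>From \<open>P \<le> U / 4\<close> follows
      \<open>U - 1 - P \<ge> 3/4 * U - 1\<close>, which is positive since
      \<open>U \<ge> 3/2\<close>.\<close>
    then have "(3/4 * U - 1)\<^sup>2 \<le> (U - 1 - P)\<^sup>2"
      using P by (intro power_mono) auto
    moreover have "2 * (3/4 * U - 1)\<^sup>2 - (U - 1)\<^sup>2 + 1/4 = U\<^sup>2 / 8 - U + 5/4"
      by (simp add: power2_eq_square algebra_simps)
    ultimately show ?thesis
      unfolding eq U4 U_def[symmetric] by linarith
  qed
qed

lemma quartic_nonneg_aux:
  fixes x y z :: real
  assumes "x * y \<ge> 0"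
  shows "(x\<^sup>2 - 1)\<^sup>2 + (y\<^sup>2 - 1)\<^sup>2 + (z\<^sup>2 - 1)\<^sup>2 + 4 * (x + y + z)\<^sup>2 - 3/4 \<ge> 0"
proof -
  define u where "u = x + y"
  \<comment> \<open>Centring \<open>z\<^sup>2\<close> at 4/3 leaves \<open>14/3 * z\<^sup>2\<close>
    to absorb \<open>8 * u * z\<close>. This costs \<open>3/7 * u\<^sup>2\<close>, which the quartic
    in \<open>u\<close> absorbs; the remaining constant is 185/1764.\<close>
  have "u^4 / 8 - u\<^sup>2 + 5/4 + (z\<^sup>2 - 1)\<^sup>2 + 4 * (u + z)\<^sup>2 =
      (z\<^sup>2 - 4/3)\<^sup>2 + 14/3 * (z + 6/7 * u)\<^sup>2 + (u\<^sup>2 - 12/7)\<^sup>2 / 8 + (17/36 - 18/49)"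
    by (simp add: power2_eq_square power4_eq_xxxx field_simps)
  also have "\<dots> \<ge> 0"
    by (intro add_nonneg_nonneg) auto
  finally have "u^4 / 8 - u\<^sup>2 + 5/4 + (z\<^sup>2 - 1)\<^sup>2 + 4 * (u + z)\<^sup>2 \<ge> 0" .
  moreover have "(z\<^sup>2 - 1)\<^sup>2 + 4 * (u + z)\<^sup>2 \<ge> 0"
    by simp
  ultimately show ?thesis
    using two_variable_bound[OF assms] unfolding u_def by linarith
qed

lemma quartic_nonneg:
  fixes x y z :: real
  shows "(x\<^sup>2 - 1)\<^sup>2 + (y\<^sup>2 - 1)\<^sup>2 + (z\<^sup>2 - 1)\<^sup>2 + 4 * (x + y + z)\<^sup>2 - 3/4 \<ge> 0"
proof -
  consider "x * y \<ge> 0" | "x * z \<ge> 0" | "y * z \<ge> 0"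
    unfolding zero_le_mult_iff by atomize_elim linarith
  then show ?thesis
  proof cases
    case 1
    then show ?thesis
      by (rule quartic_nonneg_aux)
  next
    case 2
    have "x + z + y = x + y + z"
      by simp
    then show ?thesis
      using quartic_nonneg_aux[OF 2, of y] by (simp only:)
  next
    case 3
    have "y + z + x = x + y + z"
      by simp
    then show ?thesis
      using quartic_nonneg_aux[OF 3, of x] by (simp only:)
  qed
qed

theorem theorem3p3:
  fixes p :: "real ^ 3 \<Rightarrow> real"
  assumes p_def: "\<And>x. p x = (x $ 1) ^ 4 + 2 * (x $ 1) ^ 2 + (x $ 2) ^ 4 + 2 * (x $ 2) ^ 2
      + (x $ 3) ^ 4 + 2 * (x $ 3) ^ 2 + 9 / 4
      + 8 * (x $ 1) * (x $ 2) + 8 * (x $ 1) * (x $ 3) + 8 * (x $ 2) * (x $ 3)"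
  shows "separable_plus_quadratic p \<and> nonnegative p \<and> \<not> sum_of_squares p"
proof (intro conjI notI)
  show "separable_plus_quadratic p"
  proof -
    \<comment> \<open>The squares go into the separable part, leaving the constant and the cross
      terms.\<close>
    let ?q = "\<lambda>x :: real ^ 3. 9/4 + (8 * x $ 1) * x $ 2 + (8 * x $ 1) * x $ 3 + (8 * x $ 2) * x $ 3"
    have "polynomial_degree_le ((0 + 1) + 1) (\<lambda>x :: real ^ 3. (8 * x $ i) * x $ j)" for i j
      by (intro polynomial_degree_le_mult polynomial_degree_le_const polynomial_degree_le_component)
    then have "polynomial_degree_le 2 (\<lambda>x :: real ^ 3. (8 * x $ i) * x $ j)" for i j
      by (simp add: numeral_2_eq_2)
    then have "polynomial_degree_le 2 ?q"
      by (intro polynomial_degree_le_add polynomial_degree_le_const)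
    moreover have "p x = (\<Sum>i\<in>UNIV. poly [:0, 0, 2, 0, 1:] (x $ i)) + ?q x" for x
      by (simp add: p_def sum_3 power2_eq_square power4_eq_xxxx algebra_simps)
    ultimately show ?thesis
      unfolding separable_plus_quadratic_def
      by (intro exI[of _ "\<lambda>_. [:0, 0, 2, 0, 1:]"] exI[of _ ?q]) blast
  qed
  show "nonnegative p"
    unfolding nonnegative_def
  proof
    fix x
    have "p x = ((x $ 1)\<^sup>2 - 1)\<^sup>2 + ((x $ 2)\<^sup>2 - 1)\<^sup>2 + ((x $ 3)\<^sup>2 - 1)\<^sup>2
        + 4 * (x $ 1 + x $ 2 + x $ 3)\<^sup>2 - 3/4"
      by (simp add: p_def power2_eq_square power4_eq_xxxx algebra_simps)
    then show "p x \<ge> 0"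
      using quartic_nonneg by metis
  qed
  show False if "sum_of_squares p"
  proof -
    from that obtain m :: nat and q
      where q: "\<And>i. i \<in> {1..m} \<Longrightarrow> real_polynomial_function (q i)"
        and pq: "\<And>x. p x = (\<Sum>i=1..m. (q i x)\<^sup>2)"
      unfolding sum_of_squares_def by blast
    \<comment> \<open>A crude bound by a perfect square, so that taking roots bounds each
      \<open>\<bar>q i x\<bar>\<close> quadratically. The coefficient 30 below is 3 * 2 + 3 *
      8.\<close>
    have p_le: "p x \<le> (4 * (1 + (norm x)\<^sup>2))\<^sup>2" for x
    proof -
      let ?n = "norm x"
      have x: "\<bar>x $ i\<bar> \<le> ?n" for i
        by (rule component_le_norm_cart)
      have xx: "x $ i * x $ j \<le> ?n\<^sup>2" for i j
      proof -
        have "x $ i * x $ j \<le> \<bar>x $ i\<bar> * \<bar>x $ j\<bar>"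
          by (simp flip: abs_mult)
        also have "\<dots> \<le> ?n * ?n"
          by (intro mult_mono x) auto
        finally show ?thesis
          by (simp add: power2_eq_square)
      qed
      have x4: "x $ i ^ 4 \<le> ?n ^ 4" for i
        using power_mono[OF x[of i], of 4] by simp
      have "p x \<le> 3 * ?n ^ 4 + 30 * ?n\<^sup>2 + 9/4"
        unfolding p_def using xx[of 1 1] xx[of 2 2] xx[of 3 3] xx[of 1 2] xx[of 1 3] xx[of 2 3]
          x4[of 1] x4[of 2] x4[of 3] by (simp add: power2_eq_square)
      also have "\<dots> \<le> 16 * ?n ^ 4 + 32 * ?n\<^sup>2 + 16"
        by (intro add_mono mult_right_mono) auto
      also have "\<dots> = (4 * (1 + ?n\<^sup>2))\<^sup>2"
        by (simp add: power2_eq_square power4_eq_xxxx algebra_simps)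
      finally show ?thesis .
    qed
    have "cube_functional (\<lambda>x. (q i x)\<^sup>2) \<ge> 0" if i: "i \<in> {1..m}" for i
    proof -
      have "\<bar>q i x\<bar> \<le> 4 * (1 + norm x ^ 2)" for x
      proof -
        have "(q i x)\<^sup>2 \<le> p x"
          unfolding pq using i by (intro member_le_sum) auto
        then have "(q i x)\<^sup>2 \<le> (4 * (1 + (norm x)\<^sup>2))\<^sup>2"
          using p_le[of x] by linarith
        then have "\<bar>q i x\<bar> \<le> \<bar>4 * (1 + (norm x)\<^sup>2)\<bar>"
          by (simp only: abs_le_square_iff)
        then show ?thesis
          by simp
      qed
      then have "polynomial_degree_le 2 (q i)"
        by (rule polynomial_degree_le_if_growth[OF q[OF i]])
      then obtain k l a b where "q i = ternary_quadratic k l a b"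
        using polynomial_degree_le_2_imp_ternary_quadratic by blast
      then show ?thesis
        by (simp add: cube_functional_square_nonneg)
    qed
    then have "cube_functional p \<ge> 0"
      unfolding pq[abs_def] cube_functional_sum by (intro sum_nonneg)
    \<comment> \<open>In the pseudo-moments this is 200 * (9/4 + 9 * 19/25 - 24 * 19/50).\<close>
    moreover have "cube_functional p = - 6"
      by (simp add: cube_functional_def p_def)
    ultimately show False
      by simp
  qed
qed

end
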